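(* Let $k\ge 1$, let $\lambda,\mu\in\mathcal P^k$ be $k$-bounded partitions and let $\square$ be a $k$-rectangle. Then $$\lambda\cup\square\preceq\mu \iff \text{there exists a } k\text{-bounded partition } \bar\mu \text{ such that } \mu=\bar\mu\cup\square \text{ and } \lambda\preceq\bar\mu .$$
   Context: Fix an integer $k\ge1$. A partition $\lambda=(\lambda_1\ge\dots\ge\lambda_\ell>0)$ is a finite (possibly empty) non-increasing sequence of positive integers, $|\lambda|=\sum_i\lambda_i$, $\ell(\lambda)$ is the number of parts, and $\lambda_i=0$ for $i>\ell(\lambda)$. Its diagram is the set of cells $(i,j)$ with $1\le j\le\lambda_i$ (row $i$, column $j$; row 1 is the lowest row, and "above" means larger row index). $\lambda\subseteq\mu$ means $\lambda_i\le\mu_i$ for all $i$. A partition is $k$-bounded if $\lambda_1\le k$; $\mathcal P^k$ is the set of $k$-bounded partitions. $\lambda\cup\mu$ is the partition obtained by sorting all the parts of $\lambda$ and $\mu$ together in non-increasing order. A $k$-rectangle is a partition $(\ell^{k-\ell+1})$ ($k-\ell+1$ parts equal to $\ell$) with $1\le\ell\le k$. For partitions $\rho\subseteq\gamma$, the skew diagram $\gamma/\rho$ is $\{(i,j):\rho_i<j\le\gamma_i\}$; the squares of $\rho$ are said to lie below $\gamma/\rho$. For a square $(i,j)\in\gamma$ (possibly in $\rho$), its hook-length in $\gamma/\rho$ is the number of cells of $\gamma/\rho$ of the form $(i,j')$ with $j'\ge j$ or $(i',j)$ with $i'\ge i$. For $\lambda\in\mathcal P^k$, the $k$-skew diagram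 $\lambda/^k$ is the unique skew diagram such that (i) row $i$ has $\lambda_i$ cells, (ii) no cell of the diagram has hook-length exceeding $k$, (iii) every square below the diagram has hook-length exceeding $k$. The column lengths of $\lambda/^k$ form a $k$-bounded partition, called the $k$-conjugate $\lambda^{\omega_k}$. For $\lambda,\mu\in\mathcal P^k$ write $\lambda\prec\!\!\cdot\,\mu$ when $\lambda\subseteq\mu$, $\lambda^{\omega_k}\subseteq\mu^{\omega_k}$ and $|\mu|-|\lambda|=1$. The partial order $\preceq$ on $\mathcal P^k$ is the reflexive-transitive closure of $\prec\!\!\cdot$. *)

theory Defs
  imports Main
begin

text \<open>
  Partitions are non-increasing lists of positive integers. Rows and columns of diagrams are
  numbered from 1, and \<open>part \<alpha> i\<close> is 0 for every \<open>i\<close> beyond the length of \<open>\<alpha>\<close>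
  (and for the junk index 0).
\<close>

definition is_partition :: "nat list \<Rightarrow> bool" where
  "is_partition \<alpha> \<longleftrightarrow> sorted_wrt (\<ge>) \<alpha> \<and> (\<forall>p\<in>set \<alpha>. p > 0)"

definition part :: "nat list \<Rightarrow> nat \<Rightarrow> nat" where
  "part \<alpha> i = (if 1 \<le> i \<and> i \<le> length \<alpha> then \<alpha> ! (i - 1) else 0)"

definition contained :: "nat list \<Rightarrow> nat list \<Rightarrow> bool" where
  "contained \<alpha> \<mu> \<longleftrightarrow> (\<forall>i. part \<alpha> i \<le> part \<mu> i)"

definition kbounded :: "nat \<Rightarrow> nat list set" where
  "kbounded k = {\<alpha>. is_partition \<alpha> \<and> part \<alpha> 1 \<le> k}"

definition punion :: "nat list \<Rightarrow> nat list \<Rightarrow> nat list" where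
  "punion \<alpha> \<mu> = rev (sort (\<alpha> @ \<mu>))"

definition krectangle :: "nat \<Rightarrow> nat list \<Rightarrow> bool" where
  "krectangle k R \<longleftrightarrow> (\<exists>l. 1 \<le> l \<and> l \<le> k \<and> R = replicate (k - l + 1) l)"

definition diagram :: "nat list \<Rightarrow> (nat \<times> nat) set" where
  "diagram \<alpha> = {(i, j). 1 \<le> i \<and> 1 \<le> j \<and> j \<le> part \<alpha> i}"

definition skew_cells :: "nat list \<Rightarrow> nat list \<Rightarrow> (nat \<times> nat) set" where
  "skew_cells \<gamma> \<rho> = {(i, j). 1 \<le> i \<and> part \<rho> i < j \<and> j \<le> part \<gamma> i}"

definition hook_length :: "nat list \<Rightarrow> nat list \<Rightarrow> nat \<times> nat \<Rightarrow> nat" where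
  "hook_length \<gamma> \<rho> = (\<lambda>(i, j).
     card {(i', j') \<in> skew_cells \<gamma> \<rho>. (i' = i \<and> j' \<ge> j) \<or> (j' = j \<and> i' \<ge> i)})"

text \<open>
  A skew diagram is the pair of its outer and inner shape. The set of cells alone would not say
  which squares lie below the diagram.
\<close>

definition is_kskew :: "nat \<Rightarrow> nat list \<Rightarrow> nat list \<times> nat list \<Rightarrow> bool" where
  "is_kskew k \<alpha> = (\<lambda>(\<gamma>, \<rho>).
     is_partition \<gamma> \<and> is_partition \<rho> \<and> contained \<rho> \<gamma> \<and>
     (\<forall>i\<ge>1. card {j. (i, j) \<in> skew_cells \<gamma> \<rho>} = part \<alpha> i) \<and>
     (\<forall>c\<in>skew_cells \<gamma> \<rho>. hook_length \<gamma> \<rho> c \<le> k) \<and>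
     (\<forall>c\<in>diagram \<rho>. hook_length \<gamma> \<rho> c > k))"

definition kskew :: "nat \<Rightarrow> nat list \<Rightarrow> nat list \<times> nat list" where
  "kskew k \<alpha> = (THE s. is_kskew k \<alpha> s)"

text \<open>
  The columns are listed from left to right up to the width of the outer shape. For a
  \<open>k\<close>-bounded partition none of them is empty: the topmost square of an empty column would lie
  below the diagram with hook-length at most \<open>k\<close>.
\<close>

definition kconj :: "nat \<Rightarrow> nat list \<Rightarrow> nat list" where
  "kconj k \<alpha> = (case kskew k \<alpha> of (\<gamma>, \<rho>) \<Rightarrow>
     map (\<lambda>j. card {i. (i, j) \<in> skew_cells \<gamma> \<rho>}) [1..<part \<gamma> 1 + 1])"

definition kcover :: "nat \<Rightarrow> nat list \<Rightarrow> nat list \<Rightarrow> bool" where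
  "kcover k \<alpha> \<mu> \<longleftrightarrow> \<alpha> \<in> kbounded k \<and> \<mu> \<in> kbounded k \<and>
     contained \<alpha> \<mu> \<and> contained (kconj k \<alpha>) (kconj k \<mu>) \<and>
     sum_list \<mu> = sum_list \<alpha> + 1"

definition kle :: "nat \<Rightarrow> nat list \<Rightarrow> nat list \<Rightarrow> bool" where
  "kle k = (kcover k)\<^sup>*\<^sup>*"

end

theory Submission
  imports "HOL-Library.Multiset" Defs
begin

text \<open>
  Let \<open>R\<close> be the \<open>k\<close>-rectangle with \<open>k - l + 1\<close> rows of length \<open>l\<close>. The order is generated by
  covers, so by induction along chains it is enough to compare single covers, and two facts
  suffice. First, \<open>\<alpha> \<union> R\<close> is covered by \<open>\<beta> \<union> R\<close> iff \<open>\<alpha>\<close> is covered by \<open>\<beta>\<close>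
  (\<open>kcover_punion_rectangle_iff\<close>). Second, everything that covers \<open>\<alpha> \<union> R\<close> has the form
  \<open>\<beta> \<union> R\<close> (\<open>kcover_above_rectangle\<close>).

  Both rest on an explicit construction of the \<open>k\<close>-conjugate. The \<open>k\<close>-skew diagram is built from the
  top row down, and a new bottom row of length \<open>p\<close> has to start immediately to the right of the columns that
  are higher than \<open>k - p\<close>. So the new row leaves these columns alone and adds one cell to each of
  the other nonempty columns, of which there are at most \<open>p\<close>; its remaining cells open new columns. Only the multiset of
  column lengths matters for this rule (\<open>kconj_eq_kcols\<close>, \<open>mset_add_row\<close>).

  Now insert the rows of \<open>R\<close> above the longer rows and below the others. The columns of height
  at most \<open>k - l\<close>, padded with empty ones, form \<open>l\<close> slots. Each row of length \<open>l\<close> raises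
  every slot by one, and a slot that reaches \<open>k - l + 1\<close> is frozen and replaced by an empty column. After
  \<open>k - l + 1\<close> rows every slot is back where it started and has produced one column of height
  \<open>k - l + 1\<close>. Rows longer than \<open>l\<close> do not touch these columns. Hence the
  \<open>k\<close>-conjugate of \<open>\<alpha> \<union> R\<close> is that of \<open>\<alpha>\<close> united with \<open>l\<close> parts \<open>k - l + 1\<close>
  (\<open>mset_kconj_punion_rectangle\<close>). Containment of partitions can be tested on the
  numbers of parts exceeding each \<open>h\<close>, which are additive under union, and the first fact follows.

  For the second fact, a cover that destroys \<open>R\<close> must lengthen a row of length \<open>l\<close> although
  \<open>\<alpha>\<close> has no part \<open>l\<close>. Then some slot is empty above \<open>R\<close>, so there are columns of height exactly \<open>k - l\<close>
  just before the last row of \<open>R\<close> is added. A row of length \<open>l\<close> raises them, whereas a row of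
  length \<open>l + 1\<close> leaves them alone, and lower rows never create columns higher than
  \<open>k - l\<close>. So the \<open>k\<close>-conjugate of the new partition has too few parts exceeding \<open>k - l\<close> to contain
  that of \<open>\<alpha> \<union> R\<close> (\<open>kcover_keeps_rectangle\<close>).
\<close>

section \<open>Partitions and the number of their large parts\<close>
definition num_gt :: "nat \<Rightarrow> nat list \<Rightarrow> nat" where
  "num_gt h xs = length (filter (\<lambda>x. h < x) xs)"

lemma num_gt_simps [simp]:
  "num_gt h [] = 0"
  "num_gt h (x # xs) = (if h < x then Suc (num_gt h xs) else num_gt h xs)"
  "num_gt h (xs @ ys) = num_gt h xs + num_gt h ys"
  "num_gt h (replicate n x) = (if h < x then n else 0)"
  by (auto simp: num_gt_def)

lemma num_gt_mset: "num_gt h xs = size (filter_mset (\<lambda>x. h < x) (mset xs))"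
  by (simp add: num_gt_def flip: mset_filter)

lemma num_gt_eq_0: "num_gt h xs = 0 \<longleftrightarrow> (\<forall>x\<in>set xs. x \<le> h)"
  by (auto simp: num_gt_def filter_empty_conv)

lemma sorted_wrt_ge_replicate: "sorted_wrt (\<ge>) (replicate n (x :: nat))"
  by (induction n) auto

lemma part_simps [simp]:
  "part xs 0 = 0"
  "part [] i = 0"
  "part (x # xs) (Suc i) = (if i = 0 then x else part xs i)"
  by (auto simp: part_def nth_Cons')

lemma part_tl: "1 \<le> i \<Longrightarrow> part (tl xs) i = part xs (Suc i)"
  by (cases xs) auto

text \<open>
\<open>num_gt h xs\<close> is part \<open>h + 1\<close> of the conjugate partition; this is the usual duality
between a partition and its conjugate.
\<close>
lemma less_part_iff:
  assumes "sorted_wrt (\<ge>) xs"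
  shows "h < part xs i \<longleftrightarrow> 1 \<le> i \<and> i \<le> num_gt h xs"
  using assms
proof (induction xs arbitrary: i)
  case (Cons x xs)
  show ?case
  proof (cases i)
    case (Suc i')
    have "num_gt h xs = 0" if "\<not> h < x"
      using that Cons.prems by (force simp: num_gt_eq_0)
    then show ?thesis using Suc Cons by auto
  qed simp
qed simp

text \<open>
Containment in terms of the conjugate partitions. Unlike the parts by position, the numbers
\<open>num_gt h\<close> are additive under the union of partitions, so that a common summand can be
added or cancelled on both sides.
\<close>
lemma contained_iff_num_gt:
  assumes "sorted_wrt (\<ge>) xs" "sorted_wrt (\<ge>) ys"
  shows "contained xs ys \<longleftrightarrow> (\<forall>h. num_gt h xs \<le> num_gt h ys)"
proof
  assume c: "contained xs ys"
  show "\<forall>h. num_gt h xs \<le> num_gt h ys"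
  proof
    fix h
    show "num_gt h xs \<le> num_gt h ys"
    proof (cases "num_gt h xs = 0")
      case False
      then have "h < part xs (num_gt h xs)" using less_part_iff[OF assms(1)] by simp
      also have "\<dots> \<le> part ys (num_gt h xs)" using c by (simp add: contained_def)
      finally show ?thesis using less_part_iff[OF assms(2)] by simp
    qed simp
  qed
next
  assume n: "\<forall>h. num_gt h xs \<le> num_gt h ys"
  show "contained xs ys"
    unfolding contained_def
  proof (intro allI leI notI)
    fix i
    assume "part ys i < part xs i"
    then have "1 \<le> i" "i \<le> num_gt (part ys i) xs" using less_part_iff[OF assms(1)] by auto
    then have "part ys i < part ys i"
      using n le_trans less_part_iff[OF assms(2)] by blast
    then show False by simp
  qed
qed

lemma is_partition_Cons:
  "is_partition (x # xs) \<longleftrightarrow> 0 < x \<and> part xs 1 \<le> x \<and> is_partition xs"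
  by (cases xs) (auto simp: is_partition_def)

lemma is_partition_Nil [simp]: "is_partition []"
  by (simp add: is_partition_def)

lemma is_partition_tl: "is_partition xs \<Longrightarrow> is_partition (tl xs)"
  by (cases xs) (auto simp: is_partition_Cons)

lemma kbounded_iff:
  "xs \<in> kbounded k \<longleftrightarrow> sorted_wrt (\<ge>) xs \<and> (\<forall>x\<in>set xs. 0 < x \<and> x \<le> k)"
  by (cases xs) (auto simp: kbounded_def is_partition_def)

lemma partition_eq_Nil: "is_partition xs \<Longrightarrow> part xs 1 = 0 \<Longrightarrow> xs = []"
  by (cases xs) (auto simp: is_partition_Cons)

lemma partition_eq_by_tl:
  assumes "is_partition xs" "is_partition ys" "part xs 1 = part ys 1" "tl xs = tl ys"
  shows "xs = ys"
  using assms by (cases xs; cases ys) (auto simp: is_partition_Cons)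

lemma partition_eqI:
  assumes "is_partition xs" "is_partition ys" "part xs = part ys"
  shows "xs = ys"
  using assms
proof (induction xs arbitrary: ys)
  case Nil
  then show ?case by (metis part_simps(2) partition_eq_Nil)
next
  case (Cons x xs)
  have p: "part (x # xs) i = part ys i" for i using Cons.prems by simp
  from p[of 1] Cons.prems(1) obtain y ys' where ys: "ys = y # ys'"
    by (cases ys) (auto simp: is_partition_Cons)
  have "part xs i = part ys' i" for i
    using p[of "Suc i"] ys by (cases i) auto
  moreover have "x = y" using p[of 1] ys by simp
  ultimately show ?case using Cons ys by (auto simp: is_partition_Cons)
qed

section \<open>Removing the bottom row of a skew diagram\<close>
definition col_height :: "nat list \<Rightarrow> nat list \<Rightarrow> nat \<Rightarrow> nat" where
  "col_height \<gamma> \<rho> j = card {i. (i, j) \<in> skew_cells \<gamma> \<rho>}"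

text \<open>
Moves a cell of the skew diagram without its bottom row to its place in the full diagram.
\<close>
definition raise :: "nat \<times> nat \<Rightarrow> nat \<times> nat" where
  "raise = (\<lambda>(i, j). (Suc i, j))"

lemma inj_raise: "inj raise"
  by (auto simp: raise_def inj_on_def)

lemma finite_column: "finite {i. (i, j) \<in> skew_cells \<gamma> \<rho>}"
  by (rule finite_subset[of _ "{..length \<gamma>}"]) (auto simp: skew_cells_def part_def split: if_splits)

lemma skew_cells_peel:
  "skew_cells \<gamma> \<rho> = Pair 1 ` {part \<rho> 1<..part \<gamma> 1} \<union> raise ` skew_cells (tl \<gamma>) (tl \<rho>)"
proof -
  have "(i, j) \<in> skew_cells \<gamma> \<rho> \<longleftrightarrow>
    (i, j) \<in> Pair 1 ` {part \<rho> 1<..part \<gamma> 1} \<union> raise ` skew_cells (tl \<gamma>) (tl \<rho>)" for i j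
  proof (cases "i \<le> 1")
    case True
    then show ?thesis by (cases i) (auto simp: skew_cells_def raise_def)
  next
    case False
    then obtain i' where "i = Suc i'" "1 \<le> i'" by (cases i) auto
    then show ?thesis by (auto simp: skew_cells_def raise_def part_tl image_iff)
  qed
  then show ?thesis by auto
qed

lemma diagram_peel: "diagram \<rho> = Pair 1 ` {1..part \<rho> 1} \<union> raise ` diagram (tl \<rho>)"
proof -
  have "diagram \<rho> = skew_cells \<rho> []" for \<rho>
    by (auto simp: diagram_def skew_cells_def)
  then show ?thesis using skew_cells_peel[of \<rho> "[]"] by auto
qed

lemma column_peel:
  "{i. (i, j) \<in> skew_cells \<gamma> \<rho>} =
    (if part \<rho> 1 < j \<and> j \<le> part \<gamma> 1 then {1} else {}) \<union> Suc ` {i. (i, j) \<in> skew_cells (tl \<gamma>) (tl \<rho>)}"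
  by (subst skew_cells_peel) (auto simp: raise_def)

lemma zero_notin_column: "(0, j) \<notin> skew_cells \<gamma> \<rho>"
  by (simp add: skew_cells_def)

lemma col_height_peel:
  "col_height \<gamma> \<rho> j =
    (if part \<rho> 1 < j \<and> j \<le> part \<gamma> 1 then 1 else 0) + col_height (tl \<gamma>) (tl \<rho>) j"
  unfolding col_height_def column_peel[of j \<gamma> \<rho>]
  by (auto simp: card_image finite_column zero_notin_column card_insert_if)

text \<open>
Hooks only reach to the right and upwards, so the bottom row does not affect the hooks of the cells
above it. This makes the conditions on a \<open>k\<close>-skew diagram recursive in the rows, from the
top row down.
\<close>
lemma hook_length_raise:
  assumes "1 \<le> fst c"
  shows "hook_length \<gamma> \<rho> (raise c) = hook_length (tl \<gamma>) (tl \<rho>) c"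
proof -
  obtain i j where c: "c = (i, j)" by fastforce
  have "{(i', j') \<in> skew_cells \<gamma> \<rho>. (i' = Suc i \<and> j' \<ge> j) \<or> (j' = j \<and> i' \<ge> Suc i)}
    = raise ` {(i', j') \<in> skew_cells (tl \<gamma>) (tl \<rho>). (i' = i \<and> j' \<ge> j) \<or> (j' = j \<and> i' \<ge> i)}"
    using assms c by (subst skew_cells_peel) (auto simp: raise_def image_iff)
  then show ?thesis
    using c by (simp add: hook_length_def raise_def card_image[OF inj_on_subset[OF inj_raise[unfolded raise_def]]])
qed

text \<open>
The \<open>max\<close> covers both kinds of squares: the arm of a square below the diagram is the whole
row, the arm of a cell starts at that cell.
\<close>
lemma hook_length_bottom:
  "hook_length \<gamma> \<rho> (1, j) =
    Suc (part \<gamma> 1) - max j (Suc (part \<rho> 1)) + col_height (tl \<gamma>) (tl \<rho>) j"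
proof -
  let ?A = "Pair (1::nat) ` {max j (Suc (part \<rho> 1))..part \<gamma> 1}"
  let ?B = "(\<lambda>i. (Suc i, j)) ` {i. (i, j) \<in> skew_cells (tl \<gamma>) (tl \<rho>)}"
  have "{(i', j') \<in> skew_cells \<gamma> \<rho>. (i' = 1 \<and> j' \<ge> j) \<or> (j' = j \<and> i' \<ge> 1)} = 
    Pair 1 ` ({part \<rho> 1<..part \<gamma> 1} \<inter> {j..}) \<union> ?B"
    by (subst skew_cells_peel) (auto simp: raise_def image_iff skew_cells_def)
  also have "{part \<rho> 1<..part \<gamma> 1} \<inter> {j..} = {max j (Suc (part \<rho> 1))..part \<gamma> 1}"
    by auto
  finally have "hook_length \<gamma> \<rho> (1, j) = card (?A \<union> ?B)"
    by (simp add: hook_length_def)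
  also have "\<dots> = card ?A + card ?B"
    by (rule card_Un_disjoint) (auto simp: finite_column zero_notin_column)
  also have "card ?A = Suc (part \<gamma> 1) - max j (Suc (part \<rho> 1))"
    by (simp add: card_image inj_on_def)
  also have "card ?B = col_height (tl \<gamma>) (tl \<rho>) j"
    unfolding col_height_def by (rule card_image) (simp add: inj_on_def)
  finally show ?thesis .
qed

lemma contained_peel:
  "contained \<rho> \<gamma> \<longleftrightarrow> part \<rho> 1 \<le> part \<gamma> 1 \<and> contained (tl \<rho>) (tl \<gamma>)"
proof -
  have "contained \<rho> \<gamma> \<longleftrightarrow> part \<rho> 1 \<le> part \<gamma> 1 \<and> (\<forall>i\<ge>1. part \<rho> (Suc i) \<le> part \<gamma> (Suc i))"
    unfolding contained_def
    by (metis One_nat_def Suc_le_mono le0 not0_implies_Suc part_simps(1))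
  also have "(\<forall>i\<ge>1. part \<rho> (Suc i) \<le> part \<gamma> (Suc i)) \<longleftrightarrow> contained (tl \<rho>) (tl \<gamma>)"
    unfolding contained_def
    by (metis One_nat_def Suc_leI bot_nat_0.extremum gr0I part_simps(1) part_tl)
  finally show ?thesis .
qed

lemma all_ge_1_peel: "(\<forall>i\<ge>1. Q i) \<longleftrightarrow> Q 1 \<and> (\<forall>i\<ge>1. Q (Suc i))" for Q :: "nat \<Rightarrow> bool"
proof (intro iffI allI impI)
  fix i :: nat
  assume Q: "Q 1 \<and> (\<forall>i\<ge>1. Q (Suc i))" and "1 \<le> i"
  then show "Q i" by (cases i; cases "i = 1") auto
qed auto

lemma row_lengths_peel:
  "(\<forall>i\<ge>1. card {j. (i, j) \<in> skew_cells \<gamma> \<rho>} = part (p # \<alpha>) i) \<longleftrightarrow>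
    part \<gamma> 1 - part \<rho> 1 = p \<and>
    (\<forall>i\<ge>1. card {j. (i, j) \<in> skew_cells (tl \<gamma>) (tl \<rho>)} = part \<alpha> i)"
    (is "(\<forall>i\<ge>1. ?P i) \<longleftrightarrow> ?Q \<and> (\<forall>i\<ge>1. ?R i)")
proof -
  have "{j. (1, j) \<in> skew_cells \<gamma> \<rho>} = {part \<rho> 1<..part \<gamma> 1}"
    by (auto simp: skew_cells_def)
  then have "?P 1 = ?Q" by simp
  moreover have "?P (Suc i) = ?R i" if "1 \<le> i" for i
  proof -
    have "{j. (Suc i, j) \<in> skew_cells \<gamma> \<rho>} = {j. (i, j) \<in> skew_cells (tl \<gamma>) (tl \<rho>)}"
      using that by (auto simp: skew_cells_def part_tl)
    then show ?thesis using that by simp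
  qed
  moreover have "(\<forall>i\<ge>1. ?P i) \<longleftrightarrow> ?P 1 \<and> (\<forall>i\<ge>1. ?P (Suc i))"
    by (rule all_ge_1_peel)
  ultimately show ?thesis by simp
qed

text \<open>
Given the diagram of the upper rows, the only freedom left is the shift \<open>part \<rho> 1\<close> of the new
bottom row, and it only has to meet conditions on the column heights of the upper rows.
\<close>
lemma is_kskew_peel:
  assumes "is_partition \<gamma>" "is_partition \<rho>"
  shows "is_kskew k (p # \<alpha>) (\<gamma>, \<rho>) \<longleftrightarrow>
    is_kskew k \<alpha> (tl \<gamma>, tl \<rho>) \<and> part \<gamma> 1 = part \<rho> 1 + p \<and>
    (\<forall>j. part \<rho> 1 < j \<and> j \<le> part \<gamma> 1 \<longrightarrow>
      Suc (part \<gamma> 1) - j + col_height (tl \<gamma>) (tl \<rho>) j \<le> k) \<and>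
    (\<forall>j. 1 \<le> j \<and> j \<le> part \<rho> 1 \<longrightarrow> k < p + col_height (tl \<gamma>) (tl \<rho>) j)"
proof -
  have A: "(\<forall>c\<in>skew_cells \<gamma> \<rho>. hook_length \<gamma> \<rho> c \<le> k) \<longleftrightarrow>
    (\<forall>j. part \<rho> 1 < j \<and> j \<le> part \<gamma> 1 \<longrightarrow>
      Suc (part \<gamma> 1) - j + col_height (tl \<gamma>) (tl \<rho>) j \<le> k) \<and>
    (\<forall>c\<in>skew_cells (tl \<gamma>) (tl \<rho>). hook_length (tl \<gamma>) (tl \<rho>) c \<le> k)"
  proof -
    have "hook_length \<gamma> \<rho> (raise c) = hook_length (tl \<gamma>) (tl \<rho>) c"
      if "c \<in> skew_cells (tl \<gamma>) (tl \<rho>)" for c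
      using that by (intro hook_length_raise) (auto simp: skew_cells_def)
    moreover have "hook_length \<gamma> \<rho> (1, j) = Suc (part \<gamma> 1) - j + col_height (tl \<gamma>) (tl \<rho>) j"
      if "part \<rho> 1 < j" for j
      using that by (simp only: hook_length_bottom max_absorb1 Suc_leI)
    ultimately show ?thesis
      by (subst skew_cells_peel) (simp add: ball_Un Ball_def[of "{_<.._}"])
  qed
  have B: "(\<forall>c\<in>diagram \<rho>. k < hook_length \<gamma> \<rho> c) \<longleftrightarrow>
    (\<forall>j. 1 \<le> j \<and> j \<le> part \<rho> 1 \<longrightarrow> k < p + col_height (tl \<gamma>) (tl \<rho>) j) \<and>
    (\<forall>c\<in>diagram (tl \<rho>). k < hook_length (tl \<gamma>) (tl \<rho>) c)" if g: "part \<gamma> 1 = part \<rho> 1 + p"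
  proof -
    have "hook_length \<gamma> \<rho> (raise c) = hook_length (tl \<gamma>) (tl \<rho>) c"
      if "c \<in> diagram (tl \<rho>)" for c
      using that by (intro hook_length_raise) (auto simp: diagram_def)
    moreover have "hook_length \<gamma> \<rho> (1, j) = p + col_height (tl \<gamma>) (tl \<rho>) j"
      if "j \<le> part \<rho> 1" for j
      using that g by (simp only: hook_length_bottom max_absorb2 le_SucI)
    ultimately show ?thesis
      by (subst diagram_peel) (simp add: ball_Un Ball_def[of "{_.._}"])
  qed
  show ?thesis
    unfolding is_kskew_def prod.case row_lengths_peel contained_peel[of \<rho> \<gamma>] A
    using B assms is_partition_tl by auto
qed

section \<open>The columns of the k-skew diagram, row by row\<close>
text \<open>
The effect on the column lengths \<open>cs\<close> of a new bottom row of length \<open>p\<close>. A column of height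
\<open>h\<close> at the left end of the new row gives the hook-length \<open>p + h\<close>, so the row has to start right after
the columns that are higher than \<open>k - p\<close>. At most \<open>p\<close> nonempty columns are left
(\<open>kcols_short_columns\<close>); the row passes below all of them and then opens new columns of
height 1.
\<close>
definition add_row :: "nat \<Rightarrow> nat \<Rightarrow> nat list \<Rightarrow> nat list" where
  "add_row k p cs = filter (\<lambda>x. k - p < x) cs @ map Suc (filter (\<lambda>x. x \<le> k - p) cs) @
     replicate (p - length (filter (\<lambda>x. x \<le> k - p) cs)) 1"

fun kcols :: "nat \<Rightarrow> nat list \<Rightarrow> nat list" where
  "kcols k [] = []"
| "kcols k (p # \<alpha>) = add_row k p (kcols k \<alpha>)"

fun kouter :: "nat \<Rightarrow> nat list \<Rightarrow> nat list" where
  "kouter k [] = []"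
| "kouter k (p # \<alpha>) = (num_gt (k - p) (kcols k \<alpha>) + p) # kouter k \<alpha>"

text \<open>
The case distinction keeps zeros out of the inner shape: shifts decrease from bottom to top, so
once a row has shift 0 all rows above it have shift 0, too.
\<close>
fun kinner :: "nat \<Rightarrow> nat list \<Rightarrow> nat list" where
  "kinner k [] = []"
| "kinner k (p # \<alpha>) =
    (if num_gt (k - p) (kcols k \<alpha>) = 0 then [] else num_gt (k - p) (kcols k \<alpha>) # kinner k \<alpha>)"

lemma sorted_kcols: "sorted_wrt (\<ge>) (kcols k \<alpha>)"
proof (induction \<alpha>)
  case (Cons p \<alpha>)
  have "sorted_wrt (\<ge>) (map Suc (filter (\<lambda>x. x \<le> k - p) (kcols k \<alpha>)))"
    using Cons by (simp add: sorted_wrt_map sorted_wrt_filter)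
  then show ?case
    using Cons sorted_wrt_ge_replicate[of _ 1]
    by (auto simp: add_row_def sorted_wrt_append sorted_wrt_filter)
qed simp

lemma kcols_pos: "x \<in> set (kcols k \<alpha>) \<Longrightarrow> 0 < x"
  by (induction \<alpha>) (auto simp: add_row_def)

text \<open>
Every column that is absent from the bottom row is higher than \<open>k - p\<close>, for \<open>p\<close> the length
of that row. So a column of height at most \<open>k - q \<le> k - p\<close> uses up one of the \<open>p \<le> q\<close> cells of the bottom
row.
\<close>
lemma kcols_short_columns:
  assumes "is_partition \<alpha>" "\<forall>p\<in>set \<alpha>. p \<le> q"
  shows "length (filter (\<lambda>x. x \<le> k - q) (kcols k \<alpha>)) \<le> q"
  using assms
proof (induction \<alpha> arbitrary: q)
  case (Cons p \<alpha>)
  have "\<forall>p'\<in>set \<alpha>. p' \<le> p" and "is_partition \<alpha>" using Cons.prems by (auto simp: is_partition_def)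
  then have short: "length (filter (\<lambda>x. x \<le> k - p) (kcols k \<alpha>)) \<le> p" using Cons.IH by blast
  have "p \<le> q" using Cons.prems by simp
  have "filter (\<lambda>x. x \<le> k - q) (filter (\<lambda>x. k - p < x) (kcols k \<alpha>)) = []"
    using \<open>p \<le> q\<close> by (auto simp: filter_empty_conv)
  moreover have "length (filter (\<lambda>x. x \<le> k - q) (map Suc (filter (\<lambda>x. x \<le> k - p) (kcols k \<alpha>)))) +
      length (filter (\<lambda>x. x \<le> k - q) (replicate (p - length (filter (\<lambda>x. x \<le> k - p) (kcols k \<alpha>))) 1)) \<le>
    length (map Suc (filter (\<lambda>x. x \<le> k - p) (kcols k \<alpha>))) +
      length (replicate (p - length (filter (\<lambda>x. x \<le> k - p) (kcols k \<alpha>))) (1::nat))"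
    by (intro add_mono length_filter_le)
  ultimately show ?case
    using short \<open>p \<le> q\<close> by (simp add: add_row_def)
qed simp

lemma sorted_split:
  assumes "sorted_wrt (\<ge>) (xs :: nat list)"
  shows "xs = filter (\<lambda>x. h < x) xs @ filter (\<lambda>x. x \<le> h) xs"
  using assms
proof (induction xs)
  case (Cons x xs)
  then show ?case
  proof (cases "h < x")
    case False
    then have "\<forall>y\<in>set xs. y \<le> h" using Cons.prems by auto
    then show ?thesis using False by (simp add: filter_empty_conv not_less)
  qed auto
qed simp

lemma part_add_row:
  assumes "sorted_wrt (\<ge>) cs" "length (filter (\<lambda>x. x \<le> k - p) cs) \<le> p"
  shows "part (add_row k p cs) j =
    (if num_gt (k - p) cs < j \<and> j \<le> num_gt (k - p) cs + p then 1 else 0) + part cs j"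
proof -
  define A B where "A = filter (\<lambda>x. k - p < x) cs" and "B = filter (\<lambda>x. x \<le> k - p) cs"
  have cs: "cs = A @ B" unfolding A_def B_def by (rule sorted_split[OF assms(1)])
  have r: "add_row k p cs = A @ map Suc B @ replicate (p - length B) 1"
    and n: "num_gt (k - p) cs = length A" and B: "length B \<le> p"
    using assms(2) by (simp_all add: add_row_def A_def B_def num_gt_def)
  show ?thesis
    unfolding r n unfolding cs part_def using B by (auto simp: nth_append)
qed

lemma length_add_row:
  assumes "length (filter (\<lambda>x. x \<le> k - p) cs) \<le> p"
  shows "length (add_row k p cs) = num_gt (k - p) cs + p"
  using assms by (simp add: add_row_def num_gt_def)

lemma kinner_first: "part (kinner k (p # \<alpha>)) 1 = num_gt (k - p) (kcols k \<alpha>)"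
  by simp

text \<open>
The columns to the left of the row \<open>q\<close> are higher than \<open>k - q \<ge> k - p\<close> and thus also lie to the left
of the next lower row \<open>p\<close>.
\<close>
lemma shift_mono:
  assumes "is_partition (p # q # \<alpha>)"
  shows "num_gt (k - q) (kcols k \<alpha>) \<le> num_gt (k - p) (kcols k (q # \<alpha>))"
proof -
  have "q \<le> p" using assms by (simp add: is_partition_Cons)
  then have "filter (\<lambda>x. k - p < x) (filter (\<lambda>x. k - q < x) (kcols k \<alpha>)) =
    filter (\<lambda>x. k - q < x) (kcols k \<alpha>)"
    by (auto intro!: filter_cong simp: filter_filter)
  then show ?thesis by (simp add: add_row_def num_gt_def)
qed

lemma kinner_bound:
  assumes "is_partition (p # \<alpha>)"
  shows "part (kinner k \<alpha>) 1 \<le> num_gt (k - p) (kcols k \<alpha>)"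
proof (cases \<alpha>)
  case (Cons q \<beta>)
  then show ?thesis using shift_mono assms by (simp only: kinner_first)
qed simp

lemma kouter_bound:
  assumes "is_partition (p # \<alpha>)"
  shows "part (kouter k \<alpha>) 1 \<le> num_gt (k - p) (kcols k \<alpha>) + p"
proof (cases \<alpha>)
  case (Cons q \<beta>)
  moreover have "q \<le> p" using assms Cons by (simp add: is_partition_Cons)
  ultimately show ?thesis using shift_mono[of p q \<beta> k] assms by simp
qed simp

lemma is_partition_kinner: "is_partition \<alpha> \<Longrightarrow> is_partition (kinner k \<alpha>)"
proof (induction \<alpha>)
  case (Cons p \<alpha>)
  then show ?case using kinner_bound[of p \<alpha> k] by (auto simp: is_partition_Cons)
qed simp

lemma is_partition_kouter: "is_partition \<alpha> \<Longrightarrow> is_partition (kouter k \<alpha>)"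
proof (induction \<alpha>)
  case (Cons p \<alpha>)
  then show ?case using kouter_bound[of p \<alpha> k] by (auto simp: is_partition_Cons)
qed simp

lemma tl_kinner: "is_partition (p # \<alpha>) \<Longrightarrow> tl (kinner k (p # \<alpha>)) = kinner k \<alpha>"
  using kinner_bound[of p \<alpha> k] partition_eq_Nil[of "kinner k \<alpha>"] is_partition_kinner[of \<alpha> k]
  by (auto simp: is_partition_Cons)

lemma is_kskew_Nil: "is_kskew k [] (\<gamma>, \<rho>) \<longleftrightarrow> \<gamma> = [] \<and> \<rho> = []"
proof
  assume s: "is_kskew k [] (\<gamma>, \<rho>)"
  have fin: "finite {j. (i, j) \<in> skew_cells \<gamma> \<rho>}" for i
    by (rule finite_subset[of _ "{..part \<gamma> i}"]) (auto simp: skew_cells_def)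
  have "card {j. (i, j) \<in> skew_cells \<gamma> \<rho>} = 0" if "1 \<le> i" for i
    using s that by (simp add: is_kskew_def)
  then have "{j. (i, j) \<in> skew_cells \<gamma> \<rho>} = {}" if "1 \<le> i" for i
    using that by (simp only: card_0_eq[OF fin])
  then have empty: "skew_cells \<gamma> \<rho> = {}" by (auto simp: skew_cells_def)
  have "\<not> k < hook_length \<gamma> \<rho> c" for c
    by (simp add: hook_length_def empty split: prod.split)
  then have "diagram \<rho> = {}" using s by (auto simp: is_kskew_def)
  then have "part \<rho> 1 = 0" by (subst (asm) diagram_peel) simp
  moreover from this have "part \<gamma> 1 = 0" using empty by (subst (asm) skew_cells_peel) simp
  ultimately show "\<gamma> = [] \<and> \<rho> = []" using s partition_eq_Nil by (auto simp: is_kskew_def)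
next
  assume "\<gamma> = [] \<and> \<rho> = []"
  then show "is_kskew k [] (\<gamma>, \<rho>)"
    by (simp add: is_kskew_def contained_def skew_cells_def diagram_def)
qed

text \<open>
Since column heights decrease from left to right, the columns with height \<open>> k - p\<close> are the first
\<open>s\<close> ones. The bound on the hook-lengths in the diagram keeps the new row out of these columns, and
the condition on the squares below the diagram keeps it from leaving out any other column on its left. So
the shift is \<open>s\<close>.
\<close>
lemma kskew_characterization:
  assumes "\<alpha> \<in> kbounded k"
  shows "(is_kskew k \<alpha> (\<gamma>, \<rho>) \<longleftrightarrow> \<gamma> = kouter k \<alpha> \<and> \<rho> = kinner k \<alpha>)"
    and "col_height (kouter k \<alpha>) (kinner k \<alpha>) j = part (kcols k \<alpha>) j"
proof -
  have "(\<forall>\<gamma> \<rho>. is_kskew k \<alpha> (\<gamma>, \<rho>) \<longleftrightarrow> \<gamma> = kouter k \<alpha> \<and> \<rho> = kinner k \<alpha>) \<and>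
    (\<forall>j. col_height (kouter k \<alpha>) (kinner k \<alpha>) j = part (kcols k \<alpha>) j)"
    using assms
  proof (induction \<alpha>)
    case Nil
    have "{i. (i, j) \<in> skew_cells [] []} = {}" for j by (auto simp: skew_cells_def)
    then have "col_height [] [] j = 0" for j by (simp only: col_height_def card.empty)
    then show ?case by (simp add: is_kskew_Nil)
  next
    case (Cons p \<alpha>)
    define s where "s = num_gt (k - p) (kcols k \<alpha>)"
    have p: "0 < p" "p \<le> k" and \<alpha>: "\<alpha> \<in> kbounded k"
      using Cons.prems by (auto simp: kbounded_iff)
    have part: "is_partition (p # \<alpha>)" using Cons.prems by (simp add: kbounded_def)
    have IH: "\<And>\<gamma> \<rho>. is_kskew k \<alpha> (\<gamma>, \<rho>) \<longleftrightarrow> \<gamma> = kouter k \<alpha> \<and> \<rho> = kinner k \<alpha>"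
      and height: "\<And>j. col_height (kouter k \<alpha>) (kinner k \<alpha>) j = part (kcols k \<alpha>) j"
      using Cons.IH[OF \<alpha>] by blast+
    have tall: "k - p < part (kcols k \<alpha>) j \<longleftrightarrow> 1 \<le> j \<and> j \<le> s" for j
      unfolding s_def by (rule less_part_iff[OF sorted_kcols])
    have first: "part (kinner k (p # \<alpha>)) 1 = s" "part (kouter k (p # \<alpha>)) 1 = s + p"
      by (simp_all add: s_def)
    have tails: "tl (kinner k (p # \<alpha>)) = kinner k \<alpha>" "tl (kouter k (p # \<alpha>)) = kouter k \<alpha>"
      using tl_kinner[OF part] by simp_all
    have partitions: "is_partition (kinner k (p # \<alpha>))" "is_partition (kouter k (p # \<alpha>))"
      using part is_partition_kinner is_partition_kouter by blast+
    have ex: "is_kskew k (p # \<alpha>) (kouter k (p # \<alpha>), kinner k (p # \<alpha>))"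
      unfolding is_kskew_peel[OF partitions(2,1)] tails first height
    proof (intro conjI allI impI)
      fix j assume j: "s < j \<and> j \<le> s + p"
      then have "part (kcols k \<alpha>) j \<le> k - p" using tall[of j] by auto
      then show "Suc (s + p) - j + part (kcols k \<alpha>) j \<le> k" using p j by linarith
    next
      fix j assume "1 \<le> j \<and> j \<le> s"
      then show "k < p + part (kcols k \<alpha>) j" using tall[of j] by simp
    next
      show "is_kskew k \<alpha> (kouter k \<alpha>, kinner k \<alpha>)" by (simp only: IH)
    qed simp
    have uniq: "\<gamma> = kouter k (p # \<alpha>) \<and> \<rho> = kinner k (p # \<alpha>)"
      if sk: "is_kskew k (p # \<alpha>) (\<gamma>, \<rho>)" for \<gamma> \<rho>
    proof -
      have ip: "is_partition \<gamma>" "is_partition \<rho>" using sk by (auto simp: is_kskew_def)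
      note peel = sk[unfolded is_kskew_peel[OF ip]]
      then have tl: "tl \<gamma> = kouter k \<alpha>" "tl \<rho> = kinner k \<alpha>" by (simp_all only: IH)
      have g: "part \<gamma> 1 = part \<rho> 1 + p" using peel by blast
      have "\<not> s < part \<rho> 1"
      proof
        assume "s < part \<rho> 1"
        then have "k < p + part (kcols k \<alpha>) (Suc s)" using peel by (simp add: tl height)
        moreover have "\<not> k - p < part (kcols k \<alpha>) (Suc s)" using tall[of "Suc s"] by simp
        ultimately show False using p by linarith
      qed
      moreover have "\<not> part \<rho> 1 < s"
      proof
        assume "part \<rho> 1 < s"
        then have "k - p < part (kcols k \<alpha>) (Suc (part \<rho> 1))"
          using tall[of "Suc (part \<rho> 1)"] by simp
        moreover have "p + part (kcols k \<alpha>) (Suc (part \<rho> 1)) \<le> k"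
          using peel[unfolded tl height g, THEN conjunct2, THEN conjunct2, THEN conjunct1,
              rule_format, of "Suc (part \<rho> 1)"] p
          by simp
        ultimately show False using p by linarith
      qed
      ultimately have r: "part \<rho> 1 = s" by simp
      have "\<gamma> = kouter k (p # \<alpha>)"
        by (rule partition_eq_by_tl[OF ip(1) partitions(2)]) (simp_all only: first tails tl g r)
      moreover have "\<rho> = kinner k (p # \<alpha>)"
        by (rule partition_eq_by_tl[OF ip(2) partitions(1)]) (simp_all only: first tails tl r)
      ultimately show ?thesis ..
    qed
    have "length (filter (\<lambda>x. x \<le> k - p) (kcols k \<alpha>)) \<le> p"
      using part by (intro kcols_short_columns) (auto simp: is_partition_def)
    then have "col_height (kouter k (p # \<alpha>)) (kinner k (p # \<alpha>)) j = part (kcols k (p # \<alpha>)) j" for j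
      unfolding col_height_peel[of "kouter k (p # \<alpha>)"] first tails height
      by (simp add: part_add_row[OF sorted_kcols] s_def)
    with ex uniq show ?case by blast
  qed
  then show "(is_kskew k \<alpha> (\<gamma>, \<rho>) \<longleftrightarrow> \<gamma> = kouter k \<alpha> \<and> \<rho> = kinner k \<alpha>)"
    and "col_height (kouter k \<alpha>) (kinner k \<alpha>) j = part (kcols k \<alpha>) j" by blast+
qed

theorem kconj_eq_kcols:
  assumes "\<alpha> \<in> kbounded k"
  shows "kconj k \<alpha> = kcols k \<alpha>"
proof -
  have "kskew k \<alpha> = (kouter k \<alpha>, kinner k \<alpha>)"
    unfolding kskew_def
  proof (rule the_equality)
    fix s assume "is_kskew k \<alpha> s"
    then show "s = (kouter k \<alpha>, kinner k \<alpha>)"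
      by (cases s) (simp only: kskew_characterization(1)[OF assms])
  qed (simp only: kskew_characterization(1)[OF assms])
  then have "kconj k \<alpha> = map (part (kcols k \<alpha>)) [1..<part (kouter k \<alpha>) 1 + 1]"
    using kskew_characterization(2)[OF assms]
    by (simp add: kconj_def col_height_def)
  also have "part (kouter k \<alpha>) 1 = length (kcols k \<alpha>)"
  proof (cases \<alpha>)
    case (Cons p \<beta>)
    have "length (filter (\<lambda>x. x \<le> k - p) (kcols k \<beta>)) \<le> p"
      using assms Cons by (intro kcols_short_columns) (auto simp: kbounded_def is_partition_def)
    then show ?thesis using Cons by (simp add: length_add_row)
  qed simp
  also have "map (part (kcols k \<alpha>)) [1..<length (kcols k \<alpha>) + 1] = kcols k \<alpha>"
    by (rule nth_equalityI) (auto simp: part_def nth_upt simp del: upt_Suc)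
  finally show ?thesis .
qed


section \<open>Rectangles in the k-conjugate\<close>
lemma filter_replicate_mset:
  "filter_mset P (replicate_mset n x) = (if P x then replicate_mset n x else {#})"
  by (induction n) auto

lemma mset_add_row:
  "mset (add_row k p cs) =
    filter_mset (\<lambda>x. k - p < x) (mset cs) + image_mset Suc (filter_mset (\<lambda>x. x \<le> k - p) (mset cs)) +
    replicate_mset (p - size (filter_mset (\<lambda>x. x \<le> k - p) (mset cs))) 1"
  by (simp add: add_row_def flip: mset_filter)

text \<open>
Zeros model columns that are still empty: raising them to 1 is the same as opening new columns.
\<close>
lemma image_Suc_slots:
  "image_mset Suc S =
    image_mset Suc (filter_mset (\<lambda>x. 0 < x) S) + replicate_mset (size S - size (filter_mset (\<lambda>x. 0 < x) S)) 1"
proof (induction S)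
  case (add x S)
  have "size (filter_mset (\<lambda>x. 0 < x) S) \<le> size S" by (rule size_filter_mset_lesseq)
  then show ?case using add by (auto simp: Suc_diff_le)
qed simp

text \<open>
When rows of a fixed length \<open>l\<close> are added, the columns of height at most \<open>k - l\<close> occupy \<open>l\<close>
slots, and a slot with entry 0 is an empty column. The tall columns \<open>C\<close> stay as they are and
each slot grows by one cell.
\<close>
lemma mset_add_row_slots:
  assumes cs: "mset cs = C + filter_mset (\<lambda>x. 0 < x) S"
    and C: "\<forall>x\<in>#C. k - l < x" and S: "\<forall>x\<in>#S. x \<le> k - l" and size: "size S = l"
  shows "mset (add_row k l cs) = C + image_mset Suc S"
proof -
  have "filter_mset (\<lambda>x. k - l < x) C = C" "filter_mset (\<lambda>x. x \<le> k - l) C = {#}"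
    using C by (auto simp: filter_mset_eq_conv)
  moreover have "filter_mset (\<lambda>x. k - l < x \<and> 0 < x) S = {#}"
    "filter_mset (\<lambda>x. x \<le> k - l \<and> 0 < x) S = filter_mset (\<lambda>x. 0 < x) S"
    using S by (auto intro!: filter_mset_cong)
  ultimately have "mset (add_row k l cs) = C + (image_mset Suc (filter_mset (\<lambda>x. 0 < x) S) +
      replicate_mset (l - size (filter_mset (\<lambda>x. 0 < x) S)) 1)"
    by (simp add: mset_add_row cs filter_filter_mset conj_commute del: filter_mset_eq_mempty_iff)
  then show ?thesis using image_Suc_slots[of S] size by simp
qed

text \<open>
Let \<open>m = k - l\<close>. A slot that reaches \<open>m + 1\<close> has become a tall column, and an empty column
takes its place. So the slots count modulo \<open>m + 1\<close>, and each wrap-around produces one column of height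
\<open>m + 1\<close>. The lemma is the step from \<open>t\<close> to \<open>t + 1\<close> rows; the bound on \<open>t\<close>
makes sure that no slot has wrapped around twice.
\<close>
lemma advance_slots:
  assumes "\<forall>x\<in>#S. x \<le> m" "t \<le> m"
  shows "replicate_mset (size (filter_mset (\<lambda>x. m < x + t) S)) (Suc m) +
      image_mset (\<lambda>x. Suc ((x + t) mod Suc m)) S =
    replicate_mset (size (filter_mset (\<lambda>x. m < x + Suc t) S)) (Suc m) +
      filter_mset (\<lambda>x. 0 < x) (image_mset (\<lambda>x. (x + Suc t) mod Suc m) S)"
  using assms(1)
proof (induction S)
  case (add x S)
  then have x: "x \<le> m" by simp
  consider "x + t < m" | "x + t = m" | "m < x + t" by linarith
  then show ?case
  proof cases
    case 1
    then show ?thesis using add by simp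
  next
    case 2
    then show ?thesis using add by simp
  next
    case 3
    define y where "y = x + t - Suc m"
    have y: "x + t = y + Suc m" "y < m" using 3 x assms(2) by (auto simp: y_def)
    have "(x + t) mod Suc m = y" "(x + Suc t) mod Suc m = Suc y"
      using y mod_add_self2[of y "Suc m"] mod_add_self2[of "Suc y" "Suc m"] by simp_all
    then show ?thesis using add 3 by simp
  qed
qed simp

lemma mset_add_rows_slots:
  assumes cs: "mset cs = C + filter_mset (\<lambda>x. 0 < x) S"
    and C: "\<forall>x\<in>#C. k - l < x" and S: "\<forall>x\<in>#S. x \<le> k - l" and size: "size S = l"
    and "t \<le> Suc (k - l)"
  shows "mset ((add_row k l ^^ t) cs) =
    C + replicate_mset (size (filter_mset (\<lambda>x. k - l < x + t) S)) (Suc (k - l)) +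
    filter_mset (\<lambda>x. 0 < x) (image_mset (\<lambda>x. (x + t) mod Suc (k - l)) S)"
  using assms(5)
proof (induction t)
  case 0
  have "image_mset (\<lambda>x. x mod Suc (k - l)) S = image_mset (\<lambda>x. x) S"
    by (rule image_mset_cong) (use S in \<open>simp add: less_Suc_eq_le\<close>)
  moreover have "filter_mset (\<lambda>x. k - l < x) S = {#}" using S by auto
  ultimately show ?case using cs by (simp del: filter_mset_eq_mempty_iff)
next
  case (Suc t)
  let ?D = "C + replicate_mset (size (filter_mset (\<lambda>x. k - l < x + t) S)) (Suc (k - l))"
  have "mset ((add_row k l ^^ Suc t) cs) =
    ?D + image_mset Suc (image_mset (\<lambda>x. (x + t) mod Suc (k - l)) S)"
    unfolding funpow.simps o_apply
    by (rule mset_add_row_slots) (use Suc C size in \<open>auto simp: less_Suc_eq_le[symmetric]\<close>)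
  also have "image_mset Suc (image_mset (\<lambda>x. (x + t) mod Suc (k - l)) S) =
      image_mset (\<lambda>x. Suc ((x + t) mod Suc (k - l))) S"
    by (simp add: multiset.map_comp comp_def)
  finally show ?case using advance_slots[OF S, of t] Suc.prems by (simp add: add.assoc)
qed

lemma kcols_replicate_append:
  "kcols k (replicate t l @ \<beta>) = (add_row k l ^^ t) (kcols k \<beta>)"
  by (induction t) auto

text \<open>
Short columns are padded with zeros to exactly \<open>l\<close> slots. The last conclusion records when a
padding zero is present.
\<close>
lemma kcols_slots:
  assumes "is_partition \<beta>" "\<forall>p\<in>set \<beta>. p \<le> l"
  obtains C S where "mset (kcols k \<beta>) = C + filter_mset (\<lambda>x. 0 < x) S"
    "\<forall>x\<in>#C. k - l < x" "\<forall>x\<in>#S. x \<le> k - l" "size S = l"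
    "size (filter_mset (\<lambda>x. x \<le> k - l) (mset (kcols k \<beta>))) < l \<Longrightarrow> 0 \<in># S"
proof
  let ?M = "mset (kcols k \<beta>)"
  let ?E = "filter_mset (\<lambda>x. x \<le> k - l) ?M"
  let ?S = "?E + replicate_mset (l - size ?E) 0"
  have le: "size ?E \<le> l"
    using kcols_short_columns[OF assms, of k] by (simp flip: mset_filter)
  have "filter_mset (\<lambda>x. 0 < x) ?S = ?E"
    using kcols_pos[of _ k \<beta>]
    by (auto simp: filter_filter_mset filter_replicate_mset intro!: filter_mset_cong)
  then show "?M = filter_mset (\<lambda>x. k - l < x) ?M + filter_mset (\<lambda>x. 0 < x) ?S"
    using multiset_partition[of ?M "\<lambda>x. k - l < x"] by (simp add: not_less)
  show "size ?S = l" using le by simp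
qed auto

text \<open>
After \<open>k - l + 1\<close> rows each of the \<open>l\<close> slots has gone through one full period: it has its old
entry again and has left behind exactly one column of height \<open>k - l + 1\<close>.
\<close>
lemma mset_kcols_rectangle:
  assumes "is_partition \<beta>" "\<forall>p\<in>set \<beta>. p \<le> l"
  shows "mset (kcols k (replicate (Suc (k - l)) l @ \<beta>)) =
    mset (kcols k \<beta>) + replicate_mset l (Suc (k - l))"
proof -
  obtain C S where CS: "mset (kcols k \<beta>) = C + filter_mset (\<lambda>x. 0 < x) S"
    "\<forall>x\<in>#C. k - l < x" "\<forall>x\<in>#S. x \<le> k - l" "size S = l"
    using kcols_slots[OF assms] by metis
  have "filter_mset (\<lambda>x. k - l < x + Suc (k - l)) S = S"
    by (simp add: filter_mset_eq_conv)
  moreover have "image_mset (\<lambda>x. (x + Suc (k - l)) mod Suc (k - l)) S = image_mset id S"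
    by (rule image_mset_cong) (use CS(3) in \<open>simp del: add_Suc_right add: less_Suc_eq_le\<close>)
  ultimately show ?thesis
    unfolding kcols_replicate_append using mset_add_rows_slots[OF CS order_refl] CS(1,4)
    by (simp del: funpow.simps add_Suc_right)
qed

text \<open>
Columns of height \<open>k - l + 1\<close> are higher than \<open>k - p\<close> for every \<open>p > l\<close>, so they lie to the left of
the longer rows and never change again.
\<close>
lemma mset_kcols_add_longer_rows:
  assumes "mset (kcols k \<beta>) = mset (kcols k \<beta>') + replicate_mset n (Suc (k - l))"
    and "\<forall>p\<in>set \<alpha>. l < p"
  shows "mset (kcols k (\<alpha> @ \<beta>)) = mset (kcols k (\<alpha> @ \<beta>')) + replicate_mset n (Suc (k - l))"
  using assms(2)
proof (induction \<alpha>)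
  case Nil
  then show ?case using assms(1) by simp
next
  case (Cons p \<alpha>)
  then have "k - p \<le> k - l" by (simp add: diff_le_mono2)
  then have "filter_mset (\<lambda>x. k - p < x) (replicate_mset n (Suc (k - l))) = replicate_mset n (Suc (k - l))"
    "filter_mset (\<lambda>x. x \<le> k - p) (replicate_mset n (Suc (k - l))) = {#}"
    by (simp_all add: filter_replicate_mset)
  then show ?case using Cons by (simp add: mset_add_row del: filter_mset_eq_mempty_iff)
qed

lemma mset_punion [simp]: "mset (punion \<alpha> \<beta>) = mset \<alpha> + mset \<beta>"
  by (simp add: punion_def)

lemma sorted_punion: "sorted_wrt (\<ge>) (punion \<alpha> \<beta>)"
  by (simp add: punion_def sorted_wrt_rev)

lemma punion_eqI:
  assumes "sorted_wrt (\<ge>) xs" "mset xs = mset \<alpha> + mset \<beta>"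
  shows "punion \<alpha> \<beta> = xs"
proof -
  have "sort (\<alpha> @ \<beta>) = rev xs"
    using assms by (intro properties_for_sort) (simp_all add: sorted_wrt_rev)
  then show ?thesis by (simp add: punion_def)
qed

lemma num_gt_punion: "num_gt h (punion \<alpha> \<beta>) = num_gt h \<alpha> + num_gt h \<beta>"
  by (simp add: num_gt_mset)

lemma punion_kbounded:
  assumes "\<alpha> \<in> kbounded k" "\<beta> \<in> kbounded k"
  shows "punion \<alpha> \<beta> \<in> kbounded k"
  using assms sorted_punion by (auto simp: kbounded_iff punion_def)

lemma krectangle_kbounded: "krectangle k R \<Longrightarrow> R \<in> kbounded k"
  by (auto simp: krectangle_def kbounded_iff intro: sorted_wrt_ge_replicate)

lemma punion_rectangle:
  assumes "sorted_wrt (\<ge>) \<alpha>"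
  shows "punion \<alpha> (replicate n l) =
    filter (\<lambda>x. l < x) \<alpha> @ replicate n l @ filter (\<lambda>x. x \<le> l) \<alpha>"
proof (rule punion_eqI)
  show "sorted_wrt (\<ge>) (filter (\<lambda>x. l < x) \<alpha> @ replicate n l @ filter (\<lambda>x. x \<le> l) \<alpha>)"
    using assms sorted_wrt_ge_replicate by (auto simp: sorted_wrt_append sorted_wrt_filter)
  show "mset (filter (\<lambda>x. l < x) \<alpha> @ replicate n l @ filter (\<lambda>x. x \<le> l) \<alpha>) = mset \<alpha> + mset (replicate n l)"
    using multiset_partition[of "mset \<alpha>" "\<lambda>x. l < x"] by (simp add: not_less)
qed

text \<open>
The \<open>k\<close>-conjugate turns the union with a \<open>k\<close>-rectangle into the union with the transposed
rectangle.
\<close>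
theorem mset_kconj_punion_rectangle:
  assumes "\<alpha> \<in> kbounded k" "1 \<le> l" "l \<le> k"
  shows "mset (kconj k (punion \<alpha> (replicate (Suc (k - l)) l))) =
    mset (kconj k \<alpha>) + replicate_mset l (Suc (k - l))"
proof -
  let ?A = "filter (\<lambda>x. l < x) \<alpha>" and ?B = "filter (\<lambda>x. x \<le> l) \<alpha>"
  have sorted: "sorted_wrt (\<ge>) \<alpha>" and part: "is_partition ?B"
    using assms(1) by (auto simp: kbounded_iff is_partition_def sorted_wrt_filter)
  have "replicate (Suc (k - l)) l \<in> kbounded k"
    using assms by (intro krectangle_kbounded) (auto simp: krectangle_def)
  then have "kconj k (punion \<alpha> (replicate (Suc (k - l)) l)) =
      kcols k (punion \<alpha> (replicate (Suc (k - l)) l))"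
    by (rule kconj_eq_kcols[OF punion_kbounded[OF assms(1)]])
  then have "mset (kconj k (punion \<alpha> (replicate (Suc (k - l)) l))) =
      mset (kcols k (?A @ replicate (Suc (k - l)) l @ ?B))"
    by (simp only: punion_rectangle[OF sorted])
  also have "\<dots> = mset (kcols k (?A @ ?B)) + replicate_mset l (Suc (k - l))"
    by (rule mset_kcols_add_longer_rows[OF mset_kcols_rectangle[OF part]]) auto
  also have "?A @ ?B = \<alpha>" using sorted_split[OF sorted, of l] by simp
  finally show ?thesis using kconj_eq_kcols[OF assms(1)] by simp
qed

section \<open>Covers of a partition that contains a rectangle\<close>
lemma sum_list_eq_sum_num_gt:
  "\<forall>x\<in>set xs. x \<le> N \<Longrightarrow> sum_list xs = (\<Sum>h<N. num_gt h xs)"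
proof (induction xs)
  case (Cons x xs)
  have "(\<Sum>h<N. num_gt h (x # xs)) = (\<Sum>h<N. num_gt h xs) + (\<Sum>h<N. if h < x then 1 else 0)"
    by (subst sum.distrib[symmetric]) (auto intro!: sum.cong)
  also have "(\<Sum>h<N. if h < x then 1 else 0) = card {h. h < N \<and> h < x}"
    by (simp flip: sum.inter_filter)
  also have "{h. h < N \<and> h < x} = {..<x}" using Cons.prems by auto
  finally show ?case using Cons by simp
qed simp

text \<open>
A partition that grows by one cell gains a cell in exactly one column, the column number
\<open>h\<^sub>0 + 1\<close> of its ordinary diagram.
\<close>
lemma num_gt_add_cell:
  assumes "contained xs ys" "sum_list ys = sum_list xs + 1"
    and "sorted_wrt (\<ge>) xs" "sorted_wrt (\<ge>) ys"
  obtains h\<^sub>0 where "\<And>h. num_gt h ys = num_gt h xs + (if h = h\<^sub>0 then 1 else 0)"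
proof -
  \<comment> \<open>Any bound on all parts would do; beyond it the counts vanish.\<close>
  define N where "N = sum_list ys + sum_list xs"
  have bound: "\<forall>x\<in>set xs. x \<le> N" "\<forall>y\<in>set ys. y \<le> N"
    by (auto simp: N_def dest: member_le_sum_list)
  have le: "num_gt h xs \<le> num_gt h ys" for h
    using assms contained_iff_num_gt by blast
  have sums: "(\<Sum>h<N. num_gt h ys) = (\<Sum>h<N. num_gt h xs) + 1"
    using assms(2) bound by (simp add: sum_list_eq_sum_num_gt)
  then obtain h\<^sub>0 where h\<^sub>0: "h\<^sub>0 < N" "num_gt h\<^sub>0 xs < num_gt h\<^sub>0 ys"
    using le by (metis (no_types, lifting) Suc_eq_plus1 lessThan_iff n_not_Suc_n nless_le sum.cong)
  let ?f = "\<lambda>h. num_gt h xs + (if h = h\<^sub>0 then 1 else 0)"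
  have "num_gt h ys = ?f h" for h
  proof (cases "h < N")
    case True
    have "sum ?f {..<N} = (\<Sum>h<N. num_gt h ys)"
      using sums h\<^sub>0 by (simp add: sum.distrib)
    then have "?f h = num_gt h ys"
      by (rule sum_mono_inv) (use True le h\<^sub>0 in \<open>auto simp: Suc_le_eq\<close>)
    then show ?thesis by simp
  next
    case False
    then have "num_gt h xs = 0" "num_gt h ys = 0"
      using bound by (auto simp: num_gt_eq_0)
    then show ?thesis using False h\<^sub>0 by simp
  qed
  then show thesis by (rule that)
qed

text \<open>
Column lengths of the ordinary diagram determine the multiplicities of the parts.
\<close>
lemma num_gt_count: "num_gt j xs = num_gt (Suc j) xs + count (mset xs) (Suc j)"
  by (induction xs) (auto simp: not_less)

lemma partition_eq_by_num_gt:
  assumes "is_partition xs" "is_partition ys" "\<And>h. num_gt h xs = num_gt h ys"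
  shows "xs = ys"
proof -
  have "contained xs ys" "contained ys xs"
    using assms contained_iff_num_gt by (auto simp: is_partition_def)
  then show ?thesis using assms by (intro partition_eqI) (auto simp: contained_def fun_eq_iff intro!: antisym)
qed

text \<open>
Rows longer than \<open>l\<close> only extend columns of height at most \<open>k - l - 1\<close>, hence create no new
column higher than \<open>k - l\<close>. The hypothesis \<open>l < k\<close> matters for the columns of height 1 that
are newly opened.
\<close>
lemma num_gt_add_longer_row:
  assumes "l < p" "l < k"
  shows "num_gt (k - l) (add_row k p cs) = num_gt (k - l) cs"
proof -
  have "filter (\<lambda>x. k - l < x) (filter (\<lambda>x. k - p < x) cs) = filter (\<lambda>x. k - l < x) cs"
    using assms by (auto simp: filter_filter intro!: filter_cong)
  moreover have "num_gt (k - l) (map Suc (filter (\<lambda>x. x \<le> k - p) cs)) = 0"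
    using assms by (auto simp: num_gt_eq_0)
  ultimately show ?thesis using assms by (simp add: add_row_def num_gt_def)
qed

lemma num_gt_add_longer_rows:
  assumes "l < k" "\<forall>p\<in>set \<alpha>. l < p"
  shows "num_gt (k - l) (kcols k (\<alpha> @ \<beta>)) = num_gt (k - l) (kcols k \<beta>)"
  using assms by (induction \<alpha>) (simp_all add: num_gt_add_longer_row)

lemma num_gt_add_row_critical:
  assumes "k - l \<in> set cs"
  shows "num_gt (k - l) cs < num_gt (k - l) (add_row k l cs)"
proof -
  have "Suc (k - l) \<in> set (map Suc (filter (\<lambda>x. x \<le> k - l) cs))" using assms by simp
  then have "num_gt (k - l) (map Suc (filter (\<lambda>x. x \<le> k - l) cs)) \<noteq> 0"
    unfolding num_gt_eq_0 by (metis Suc_n_not_le_n)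
  moreover have "num_gt (k - l) (filter (\<lambda>x. k - l < x) cs) = num_gt (k - l) cs"
    by (simp add: num_gt_def filter_filter)
  ultimately show ?thesis by (simp add: add_row_def)
qed

text \<open>
As all parts of \<open>\<beta>\<close> are less than \<open>l\<close>, there are at most \<open>l - 1\<close> short columns, so one of the
\<open>l\<close> slots is empty. After \<open>k - l\<close> rows of length \<open>l\<close> this slot has height \<open>k - l\<close>.
\<close>
lemma critical_column:
  assumes "is_partition \<beta>" "\<forall>p\<in>set \<beta>. p < l" "1 \<le> l" "l < k"
  shows "k - l \<in> set (kcols k (replicate (k - l) l @ \<beta>))"
proof -
  have le: "\<forall>p\<in>set \<beta>. p \<le> l" "\<forall>p\<in>set \<beta>. p \<le> l - 1" using assms(2) by auto
  obtain C S where CS: "mset (kcols k \<beta>) = C + filter_mset (\<lambda>x. 0 < x) S"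
    "\<forall>x\<in>#C. k - l < x" "\<forall>x\<in>#S. x \<le> k - l" "size S = l"
    and zero: "size (filter_mset (\<lambda>x. x \<le> k - l) (mset (kcols k \<beta>))) < l \<Longrightarrow> 0 \<in># S"
    using kcols_slots[OF assms(1) le(1)] by metis
  have "size (filter_mset (\<lambda>x. x \<le> k - l) (mset (kcols k \<beta>))) \<le>
      size (filter_mset (\<lambda>x. x \<le> k - (l - 1)) (mset (kcols k \<beta>)))"
    by (intro size_mset_mono filter_mset_mono_strong) auto
  also have "\<dots> \<le> l - 1"
    using kcols_short_columns[OF assms(1) le(2), of k] by (simp flip: mset_filter)
  finally have "0 \<in># S" using zero assms(3) by simp
  then have "k - l \<in># filter_mset (\<lambda>x. 0 < x) (image_mset (\<lambda>x. (x + (k - l)) mod Suc (k - l)) S)"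
    using assms(4) by (force simp: image_iff)
  then have "k - l \<in># mset ((add_row k l ^^ (k - l)) (kcols k \<beta>))"
    unfolding mset_add_rows_slots[OF CS le_SucI[OF order_refl]] by (simp only: union_iff disj_not1 simp_thms)
  then show ?thesis by (simp add: kcols_replicate_append)
qed

text \<open>
If the bottom row of the rectangle is lengthened to \<open>l + 1\<close>, it can no longer raise the critical
columns from \<open>k - l\<close> to \<open>k - l + 1\<close>, as the unchanged row does. Neither this row nor any lower one
makes up for the loss.
\<close>
lemma num_gt_broken_rectangle:
  assumes "is_partition \<beta>" "\<forall>p\<in>set \<beta>. p < l" "1 \<le> l" "l < k" "\<forall>p\<in>set \<alpha>. l < p"
  shows "num_gt (k - l) (kcols k (\<alpha> @ Suc l # replicate (k - l) l @ \<beta>)) <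
    num_gt (k - l) (kcols k (\<alpha> @ replicate (Suc (k - l)) l @ \<beta>))"
  using num_gt_add_row_critical[OF critical_column[OF assms(1-4)]] assms(4,5)
  by (simp add: num_gt_add_longer_rows num_gt_add_longer_row)

text \<open>
A new cell can only destroy the rectangle if it lengthens the lowest row of length \<open>l\<close>, and if
the rectangle contains all rows of that length. Then the number of columns of the \<open>k\<close>-skew
diagram that are higher than \<open>k - l\<close> drops, against the containment of the \<open>k\<close>-conjugates.
\<close>
lemma kcover_keeps_rectangle:
  assumes "\<alpha> \<in> kbounded k" "1 \<le> l" "l \<le> k"
    and cover: "kcover k (punion \<alpha> (replicate (Suc (k - l)) l)) \<mu>"
  shows "replicate_mset (Suc (k - l)) l \<subseteq># mset \<mu>"
proof (rule ccontr)
  let ?U = "punion \<alpha> (replicate (Suc (k - l)) l)"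
  assume "\<not> ?thesis"
  then have few: "count (mset \<mu>) l < Suc (k - l)"
    by (simp only: count_le_replicate_mset_subset_eq[symmetric] not_le)
  have \<mu>: "\<mu> \<in> kbounded k" and sorted: "sorted_wrt (\<ge>) \<alpha>" and U: "?U \<in> kbounded k"
    using cover assms(1) by (auto simp: kcover_def kbounded_iff)
  obtain h\<^sub>0 where h\<^sub>0: "\<And>h. num_gt h \<mu> = num_gt h ?U + (if h = h\<^sub>0 then 1 else 0)"
    using num_gt_add_cell[of ?U \<mu>] cover \<mu> sorted_punion by (auto simp: kcover_def kbounded_iff)
  have "Suc (l - 1) = l" using assms(2) by simp
  then have "count (mset \<mu>) l + (if l = h\<^sub>0 then 1 else 0) =
      count (mset ?U) l + (if l - 1 = h\<^sub>0 then 1 else 0)"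
    using num_gt_count[of "l - 1" \<mu>] num_gt_count[of "l - 1" ?U] h\<^sub>0[of l] h\<^sub>0[of "l - 1"] by simp
  \<comment> \<open>The multiplicity of \<open>l\<close> in \<open>?U\<close> is at least \<open>k - l + 1\<close>, so it has to drop.\<close>
  then have h\<^sub>0_eq: "h\<^sub>0 = l" and "count (mset \<alpha>) l = 0"
    using few by (auto split: if_splits)
  then have notin: "l \<notin> set \<alpha>" by simp
  define A B where "A = filter (\<lambda>x. l < x) \<alpha>" and "B = filter (\<lambda>x. x \<le> l) \<alpha>"
  have B_less: "\<forall>p\<in>set B. p < l" using notin by (auto simp: B_def le_less)
  have A_gr: "\<forall>p\<in>set A. l < p" by (simp add: A_def)
  have U_eq: "?U = A @ replicate (Suc (k - l)) l @ B"
    unfolding A_def B_def by (rule punion_rectangle[OF sorted])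
  have sorted_AB: "sorted_wrt (\<ge>) A" "sorted_wrt (\<ge>) B"
    using sorted by (simp_all add: A_def B_def sorted_wrt_filter)
  have pos: "\<forall>p\<in>set A \<union> set B. 0 < p" using assms(1) by (auto simp: A_def B_def kbounded_iff)
  have "\<mu> = A @ Suc l # replicate (k - l) l @ B"
  proof (rule partition_eq_by_num_gt)
    show "is_partition \<mu>" using \<mu> by (simp add: kbounded_def)
    show "is_partition (A @ Suc l # replicate (k - l) l @ B)"
      using sorted_AB A_gr B_less pos assms(2)
      by (fastforce simp: is_partition_def sorted_wrt_append sorted_wrt_ge_replicate)
    show "num_gt h \<mu> = num_gt h (A @ Suc l # replicate (k - l) l @ B)" for h
      unfolding h\<^sub>0 h\<^sub>0_eq U_eq by auto
  qed
  moreover have "l < k"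
    using calculation \<mu> by (auto simp: kbounded_iff)
  moreover have "is_partition B" using sorted_AB pos by (simp add: is_partition_def)
  ultimately have "num_gt (k - l) (kcols k \<mu>) < num_gt (k - l) (kcols k ?U)"
    unfolding U_eq using num_gt_broken_rectangle B_less A_gr assms(2) by blast
  moreover have "contained (kcols k ?U) (kcols k \<mu>)"
    using cover unfolding kcover_def kconj_eq_kcols[OF U] kconj_eq_kcols[OF \<mu>] by blast
  ultimately show False
    using contained_iff_num_gt[OF sorted_kcols sorted_kcols] by (meson not_less)
qed

text \<open>
All three conditions on a cover are comparisons of additive quantities, to which the rectangle contributes
equally on both sides.
\<close>
lemma kcover_punion_rectangle_iff:
  assumes "\<alpha> \<in> kbounded k" "\<beta> \<in> kbounded k" "krectangle k R"
  shows "kcover k (punion \<alpha> R) (punion \<beta> R) \<longleftrightarrow> kcover k \<alpha> \<beta>"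
proof -
  obtain l where l: "1 \<le> l" "l \<le> k" and R: "R = replicate (Suc (k - l)) l"
    using assms(3) by (auto simp: krectangle_def)
  have kb: "punion \<alpha> R \<in> kbounded k" "punion \<beta> R \<in> kbounded k"
    using assms krectangle_kbounded punion_kbounded by blast+
  have sorted: "sorted_wrt (\<ge>) (kconj k \<gamma>)" if "\<gamma> \<in> kbounded k" for \<gamma>
    using that by (simp add: kconj_eq_kcols sorted_kcols)
  have "num_gt h (kconj k (punion \<gamma> R)) = num_gt h (kconj k \<gamma>) + num_gt h (replicate l (Suc (k - l)))"
    if "\<gamma> \<in> kbounded k" for h \<gamma>
    unfolding R num_gt_mset mset_kconj_punion_rectangle[OF that l] by simp
  then have "contained (kconj k (punion \<alpha> R)) (kconj k (punion \<beta> R)) \<longleftrightarrow>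
      contained (kconj k \<alpha>) (kconj k \<beta>)"
    using assms kb sorted by (simp add: contained_iff_num_gt)
  moreover have "contained (punion \<alpha> R) (punion \<beta> R) \<longleftrightarrow> contained \<alpha> \<beta>"
    using assms(1,2) by (simp add: contained_iff_num_gt sorted_punion kbounded_iff num_gt_punion)
  moreover have "sum_list (punion \<gamma> R) = sum_list \<gamma> + sum_list R" for \<gamma>
    by (simp flip: sum_mset_sum_list)
  ultimately show ?thesis using assms kb by (simp add: kcover_def)
qed

lemma kcover_above_rectangle:
  assumes "\<alpha> \<in> kbounded k" "krectangle k R" "kcover k (punion \<alpha> R) \<mu>"
  obtains \<beta> where "\<beta> \<in> kbounded k" "\<mu> = punion \<beta> R" "kcover k \<alpha> \<beta>"
proof -
  obtain l where l: "1 \<le> l" "l \<le> k" and R: "R = replicate (Suc (k - l)) l"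
    using assms(2) by (auto simp: krectangle_def)
  define \<beta> where "\<beta> = rev (sorted_list_of_multiset (mset \<mu> - mset R))"
  have \<mu>: "\<mu> \<in> kbounded k" using assms(3) by (simp add: kcover_def)
  have "mset R \<subseteq># mset \<mu>"
    using kcover_keeps_rectangle assms(1,3) l R by simp
  then have "mset \<mu> = mset \<beta> + mset R" by (simp add: \<beta>_def)
  then have eq: "\<mu> = punion \<beta> R"
    using \<mu> punion_eqI[of \<mu> \<beta> R] by (simp add: kbounded_iff)
  have "set \<beta> \<subseteq> set \<mu>" by (auto simp: \<beta>_def dest: in_diffD)
  moreover have "sorted_wrt (\<ge>) \<beta>"
    by (simp add: \<beta>_def sorted_wrt_rev sorted_sorted_list_of_multiset)
  ultimately have \<beta>: "\<beta> \<in> kbounded k" using \<mu> by (auto simp: kbounded_iff)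
  then have "kcover k \<alpha> \<beta>" using assms kcover_punion_rectangle_iff eq by blast
  with \<beta> eq that show thesis by blast
qed

theorem theorem20:
  fixes k :: nat and \<alpha> \<mu> R :: "nat list"
  assumes "k \<ge> 1"
    and "\<alpha> \<in> kbounded k"
    and "\<mu> \<in> kbounded k"
    and "krectangle k R"
  shows "kle k (punion \<alpha> R) \<mu> \<longleftrightarrow>
    (\<exists>\<nu>. \<nu> \<in> kbounded k \<and> \<mu> = punion \<nu> R \<and> kle k \<alpha> \<nu>)"
proof
  assume "kle k (punion \<alpha> R) \<mu>"
  then show "\<exists>\<nu>. \<nu> \<in> kbounded k \<and> \<mu> = punion \<nu> R \<and> kle k \<alpha> \<nu>"
    unfolding kle_def
  proof (induction rule: rtranclp_induct)
    case base
    then show ?case using assms(2) by blast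
  next
    case (step \<mu> \<mu>')
    then obtain \<nu> where \<nu>: "\<nu> \<in> kbounded k" "\<mu> = punion \<nu> R" "(kcover k)\<^sup>*\<^sup>* \<alpha> \<nu>" by blast
    with step.hyps(2) obtain \<nu>' where "\<nu>' \<in> kbounded k" "\<mu>' = punion \<nu>' R" "kcover k \<nu> \<nu>'"
      using kcover_above_rectangle[OF \<nu>(1) assms(4)] by blast
    moreover from this(3) \<nu>(3) have "(kcover k)\<^sup>*\<^sup>* \<alpha> \<nu>'" by simp
    ultimately show ?case by blast
  qed
next
  assume "\<exists>\<nu>. \<nu> \<in> kbounded k \<and> \<mu> = punion \<nu> R \<and> kle k \<alpha> \<nu>"
  then obtain \<nu> where \<mu>: "\<mu> = punion \<nu> R" and "(kcover k)\<^sup>*\<^sup>* \<alpha> \<nu>"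
    by (auto simp: kle_def)
  from this(2) have "(kcover k)\<^sup>*\<^sup>* (punion \<alpha> R) (punion \<nu> R)"
  proof (induction rule: rtranclp_induct)
    case (step \<nu> \<nu>')
    then have "kcover k (punion \<nu> R) (punion \<nu>' R)"
      using kcover_punion_rectangle_iff assms(4) by (auto simp: kcover_def)
    with step.IH show ?case by simp
  qed simp
  then show "kle k (punion \<alpha> R) \<mu>" by (simp add: kle_def \<mu>)
qed

end
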